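(* Let $E_1$ and $E_2$ be ordinary elliptic curves defined over $\mathbb{F}_q$, $q=p^r$ with $p\neq 2,3$ prime, such that $j(E_1)=j(E_2)$. Then $\#E_1(\mathbb{F}_q)=\#E_2(\mathbb{F}_q)$ if and only if $E_1(\mathbb{F}_q)\cong E_2(\mathbb{F}_q)$ as groups.
   Context: For $E:y^2=x^3+Ax+B$, the $j$-invariant is $j(E)=1728\cdot\frac{4A^3}{4A^3+27B^2}$. $E(\mathbb{F}_q)$ is the group of $\mathbb{F}_q$-rational points. $E$ is supersingular if $\#E(\mathbb{F}_q)\equiv 1\pmod p$ and ordinary otherwise. *)

theory Defs
  imports
    "HOL-Algebra.Group"
    "HOL-Computational_Algebra.Primes"
    "HOL-Library.Cardinality"
    "HOL-Number_Theory.Cong"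
begin

text \<open>The pair \<open>A\<close>, \<open>B\<close> stands for the short Weierstrass curve \<open>y\<^sup>2 = x\<^sup>3 + A x + B\<close>, and the field
  \<open>\<bbbF>\<^sub>q\<close> is the type \<open>'a\<close>.  The definitions below are meant for characteristic different from 2
  and 3.\<close>

definition elliptic_curve :: "'a::field \<Rightarrow> 'a \<Rightarrow> bool" where
  "elliptic_curve A B \<longleftrightarrow> 4 * A ^ 3 + 27 * B ^ 2 \<noteq> 0"

definition j_invariant :: "'a::field \<Rightarrow> 'a \<Rightarrow> 'a" where
  "j_invariant A B = 1728 * (4 * A ^ 3 / (4 * A ^ 3 + 27 * B ^ 2))"

datatype 'a point = Infinity | Affine 'a 'a

definition ec_points :: "'a::field \<Rightarrow> 'a \<Rightarrow> 'a point set" where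
  "ec_points A B = insert Infinity {Affine x y |x y. y ^ 2 = x ^ 3 + A * x + B}"

text \<open>Chord-and-tangent addition.  For two points of the curve with the same first coordinate,
  \<open>y\<^sub>1 = - y\<^sub>2\<close> says that they are opposite; otherwise they coincide, \<open>y\<^sub>1\<close> is nonzero, and
  the slope is that of the tangent line.\<close>

fun ec_add :: "'a::field \<Rightarrow> 'a point \<Rightarrow> 'a point \<Rightarrow> 'a point" where
  "ec_add A Infinity Q = Q"
| "ec_add A P Infinity = P"
| "ec_add A (Affine x1 y1) (Affine x2 y2) =
     (if x1 = x2 \<and> y1 = - y2 then Infinity
      else let s = (if x1 = x2 then (3 * x1 ^ 2 + A) / (2 * y1) else (y2 - y1) / (x2 - x1));
               x3 = s ^ 2 - x1 - x2
           in Affine x3 (s * (x1 - x3) - y1))"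

definition ec_group :: "'a::field \<Rightarrow> 'a \<Rightarrow> 'a point monoid" where
  "ec_group A B = \<lparr>carrier = ec_points A B, monoid.mult = ec_add A, one = Infinity\<rparr>"

definition supersingular :: "'a::finite_field \<Rightarrow> 'a \<Rightarrow> bool" where
  "supersingular A B \<longleftrightarrow> [card (ec_points A B) = 1] (mod CHAR('a))"

definition ordinary :: "'a::finite_field \<Rightarrow> 'a \<Rightarrow> bool" where
  "ordinary A B \<longleftrightarrow> \<not> supersingular A B"

end

theory Submission
  imports Defs "HOL-Computational_Algebra.Polynomial" "HOL-Number_Theory.Residues"
begin

text \<open>
  Write \<open>q = 2n + 1\<close>. In \<open>\<bbbF>\<^sub>q\<close> the number of square roots of \<open>c\<close> is \<open>1 + c^n\<close>, so
  \<open>#E(\<bbbF>\<^sub>q) = 1 + S\<close> modulo \<open>p\<close> with \<open>S = \<Sum>\<^sub>x (x^3 + A x + B)^n\<close>, and \<open>E\<close> is ordinary iff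
  \<open>S \<noteq> 0\<close>. Expanding and using that \<open>\<Sum>\<^sub>x x^m\<close> vanishes for \<open>0 \<le> m < 4n\<close>, \<open>m \<noteq> 2n\<close>, shows how
  \<open>S\<close> depends on the twist: replacing \<open>(A, B)\<close> by \<open>(u^2 A, u^3 B)\<close> multiplies it by \<open>u^n\<close>,
  replacing \<open>(A, 0)\<close> by \<open>(v A, 0)\<close> multiplies it by \<open>v^(n/2)\<close>, and replacing \<open>(0, B)\<close> by
  \<open>(0, v B)\<close> multiplies it by \<open>v^(n/3)\<close>. Two curves with the same \<open>j\<close> are related in one of these
  ways; if they are ordinary and have equally many points, the factor is 1, so \<open>u\<close> is a square, or
  \<open>v\<close> a fourth or a sixth power, and the curves are isomorphic over \<open>\<bbbF>\<^sub>q\<close>.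
\<close>

section \<open>Powers and power sums in a finite field\<close>

lemma card_power_eq_le:
  fixes c :: "'a::idom"
  assumes "k > 0"
  shows "finite {x. x ^ k = c}" and "card {x. x ^ k = c} \<le> k"
proof -
  define P where "P = Polynomial.monom 1 k - [:c:]"
  have "Polynomial.coeff P k = 1"
    using assms by (cases k) (simp_all add: P_def)
  then have "P \<noteq> 0"
    by auto
  have "degree P \<le> k"
    unfolding P_def by (intro degree_diff_le degree_monom_le) auto
  have roots: "{x. x ^ k = c} = {x. poly P x = 0}"
    by (auto simp: P_def poly_monom)
  show "finite {x. x ^ k = c}"
    unfolding roots using \<open>P \<noteq> 0\<close> by (rule poly_roots_finite)
  show "card {x. x ^ k = c} \<le> k"
    unfolding roots using card_poly_roots_bound[OF \<open>P \<noteq> 0\<close>] \<open>degree P \<le> k\<close> by linarith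
qed

lemma finite_field_power_card_minus_1:
  fixes x :: "'a::finite_field"
  assumes "x \<noteq> 0"
  shows "x ^ (CARD('a) - 1) = 1"
proof -
  have "x * x ^ (CARD('a) - 1) = x ^ CARD('a)"
    by (metis power_eq_if zero_less_card_finite less_numeral_extra(3))
  then show ?thesis
    using assms by (simp add: finite_field_power_card_eq_same)
qed

lemma card_nonzero: "card {x::'a::{finite,zero}. x \<noteq> 0} = CARD('a) - 1"
proof -
  have "{x::'a. x \<noteq> 0} = UNIV - {0}"
    by auto
  then show ?thesis
    by simp
qed

text \<open>At most \<open>d\<close> units share a \<open>d\<close>-th power, so the
  \<open>d * k\<close> units have at least \<open>k\<close> distinct \<open>d\<close>-th powers. All
  of these satisfy \<open>x ^ k = 1\<close>, which has at most \<open>k\<close> solutions, so they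
  exhaust the solutions. Counting thus stands in for a generator of the unit group.\<close>

lemma is_dth_power:
  fixes v :: "'a::finite_field"
  assumes dk: "CARD('a) - 1 = d * k" and pos: "d > 0" "k > 0" and v: "v ^ k = 1"
  obtains w where "w \<noteq> 0" and "w ^ d = v"
proof -
  define U where "U = {x::'a. x \<noteq> 0}"
  define I where "I = (\<lambda>x. x ^ d) ` U"
  have "I \<subseteq> {x. x ^ k = 1}"
    using finite_field_power_card_minus_1[where ?'a = 'a, unfolded dk]
    by (auto simp: I_def U_def simp flip: power_mult)
  moreover have "card {x::'a. x ^ k = 1} \<le> card I"
  proof -
    have "U \<subseteq> (\<Union>c\<in>I. {x. x ^ d = c})"
      by (auto simp: I_def)
    then have "d * k \<le> card (\<Union>c\<in>I. {x::'a. x ^ d = c})"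
      using card_mono[OF finite, of U] card_nonzero[where ?'a = 'a] dk by (simp add: U_def)
    also have "\<dots> \<le> (\<Sum>c\<in>I. card {x::'a. x ^ d = c})"
      by (rule card_UN_le) simp
    also have "\<dots> \<le> (\<Sum>c\<in>I. d)"
      by (intro sum_mono card_power_eq_le pos)
    finally have "k \<le> card I"
      using pos by simp
    then show ?thesis
      using card_power_eq_le(2)[OF pos(2), of "1::'a"] by linarith
  qed
  ultimately have "I = {x. x ^ k = 1}"
    by (intro card_seteq) auto
  with v have "v \<in> I"
    by simp
  then show ?thesis
    using that by (auto simp: I_def U_def)
qed

text \<open>Scaling the summation variable by a unit \<open>g\<close> multiplies the sum by
  \<open>g ^ m\<close>, so one \<open>g\<close> with \<open>g ^ m \<noteq> 1\<close>
  suffices.\<close>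

lemma sum_power_eq_0:
  assumes "m > 0" and "m < 2 * (CARD('a) - 1)" and "m \<noteq> CARD('a) - 1"
  shows "(\<Sum>x::'a::finite_field\<in>UNIV. x ^ m) = 0"
proof -
  define N where "N = CARD('a) - 1"
  \<comment> \<open>Reducing \<open>m\<close> modulo \<open>N\<close> leaves the powers of units
    unchanged, and \<open>x ^ m' = 1\<close> then has fewer than \<open>N\<close> solutions.\<close>
  obtain m' where m': "0 < m'" "m' < N" "m = m' \<or> m = m' + N"
  proof (cases "m < N")
    case False
    with assms show ?thesis
      by (intro that[of "m - N"]) (auto simp: N_def)
  qed (use assms that in auto)
  have "card {x::'a. x ^ m' = 1} < card {x::'a. x \<noteq> 0}"
    using card_power_eq_le(2)[OF m'(1), of "1::'a"] m'(2) by (simp add: card_nonzero N_def)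
  then have "\<not> {x::'a. x \<noteq> 0} \<subseteq> {x. x ^ m' = 1}"
    by (meson card_mono finite linorder_not_less)
  then obtain g :: 'a where g: "g \<noteq> 0" "g ^ m' \<noteq> 1"
    by auto
  then have "g ^ m \<noteq> 1"
    using m'(3) finite_field_power_card_minus_1[of g, folded N_def] by (auto simp: power_add)
  have "(\<Sum>x\<in>UNIV. x ^ m) = (\<Sum>x\<in>UNIV. (g * x) ^ m)"
    by (rule sum.reindex_bij_witness[of _ "\<lambda>x. g * x" "\<lambda>x. x / g"]) (use g in auto)
  also have "\<dots> = g ^ m * (\<Sum>x\<in>UNIV. x ^ m)"
    by (simp add: power_mult_distrib sum_distrib_left)
  finally show ?thesis
    using \<open>g ^ m \<noteq> 1\<close> by simp
qed

section \<open>Point counts modulo the characteristic\<close>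

text \<open>Euler's criterion: \<open>c ^ n\<close> is 0, 1 or -1 when \<open>c\<close> is zero, a
  nonzero square or a non-square.\<close>

lemma of_nat_card_sqrt:
  fixes c :: "'a::finite_field"
  assumes "CARD('a) = 2 * n + 1" and "n > 0" and two: "(2::'a) \<noteq> 0"
  shows "of_nat (card {y. y ^ 2 = c}) = 1 + c ^ n"
proof (cases "c = 0")
  case True
  then show ?thesis
    using assms by simp
next
  case False
  have card: "CARD('a) - 1 = 2 * n"
    using assms by simp
  have "(c ^ n) ^ 2 = 1"
    using finite_field_power_card_minus_1[OF False, unfolded card] by (simp add: mult.commute flip: power_mult)
  then consider "c ^ n = 1" | "c ^ n = -1"
    by (metis power2_eq_1_iff)
  then show ?thesis
  proof cases
    case 1
    then obtain w where w: "w \<noteq> 0" "w ^ 2 = c"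
      using is_dth_power[OF card _ \<open>n > 0\<close>] by auto
    have "{y. y ^ 2 = c} = {w, - w}"
      using w(2) by (auto simp: power2_eq_iff)
    moreover have "w \<noteq> - w"
      using w(1) two by (metis add.right_inverse mult_2 mult_eq_0_iff)
    ultimately show ?thesis
      using 1 by simp
  next
    case 2
    have "y ^ 2 \<noteq> c" for y
    proof
      assume "y ^ 2 = c"
      then have "c ^ n = y ^ (2 * n)" and "y \<noteq> 0"
        using False by (auto simp: power_mult)
      then have "c ^ n = 1"
        using finite_field_power_card_minus_1[of y, unfolded card] by simp
      with 2 two show False
        by (metis add.right_inverse one_add_one)
    qed
    then show ?thesis
      using 2 by simp
  qed
qed

text \<open>For q = 2n + 1 this is the image in the field of minus the trace of Frobenius.\<close>

definition trace_sum :: "nat \<Rightarrow> 'a::finite_field \<Rightarrow> 'a \<Rightarrow> 'a" where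
  "trace_sum n A B = (\<Sum>x\<in>UNIV. (x ^ 3 + A * x + B) ^ n)"

lemma card_ec_points:
  fixes A B :: "'a::finite_field"
  shows "card (ec_points A B) = Suc (\<Sum>x\<in>UNIV. card {y. y ^ 2 = x ^ 3 + A * x + B})"
proof -
  define R where "R = (SIGMA x:UNIV. {y. y ^ 2 = x ^ 3 + A * x + B})"
  have eq: "ec_points A B = insert Infinity (case_prod Affine ` R)"
    by (auto simp: ec_points_def R_def image_iff)
  have "card (case_prod Affine ` R) = card R"
    by (rule card_image) (auto simp: inj_on_def)
  moreover have "Infinity \<notin> case_prod Affine ` R"
    by auto
  ultimately have "card (ec_points A B) = Suc (card R)"
    unfolding eq by simp
  then show ?thesis
    by (simp add: R_def)
qed

lemma of_nat_card_ec_points: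
  fixes A B :: "'a::finite_field"
  assumes "CARD('a) = 2 * n + 1" and "n > 0" and "(2::'a) \<noteq> 0"
  shows "of_nat (card (ec_points A B)) = 1 + trace_sum n A B"
proof -
  \<comment> \<open>The summand 1 of \<open>1 + c ^ n\<close>, taken over all \<open>x\<close>,
    contributes q, which is 0 in the field.\<close>
  have "of_nat CARD('a) = (0::'a)"
    using CHAR_dvd_CARD[where ?'a = 'a] by (simp add: of_nat_eq_0_iff_char_dvd)
  then show ?thesis
    by (simp add: card_ec_points of_nat_card_sqrt[OF assms] sum.distrib trace_sum_def)
qed

lemma ordinary_iff_trace_sum:
  fixes A B :: "'a::finite_field"
  assumes "CARD('a) = 2 * n + 1" and "n > 0" and "(2::'a) \<noteq> 0"
  shows "ordinary A B \<longleftrightarrow> trace_sum n A B \<noteq> 0"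
  using of_nat_card_ec_points[OF assms, of A B]
  by (simp add: ordinary_def supersingular_def flip: of_nat_eq_iff_cong_CHAR)

section \<open>Trace sums of twisted curves\<close>

text \<open>Substituting \<open>u * x\<close> for \<open>x\<close> pulls \<open>u ^ 3\<close> out of
  the cubic, and \<open>u ^ (3 * n)\<close> is \<open>u ^ n\<close> because
  \<open>u ^ (2 * n) = 1\<close>.\<close>

lemma trace_sum_quadratic_twist:
  fixes u :: "'a::finite_field"
  assumes "CARD('a) = 2 * n + 1" and "u \<noteq> 0"
  shows "trace_sum n (u ^ 2 * A) (u ^ 3 * B) = u ^ n * trace_sum n A B"
proof -
  have un: "u ^ (2 * n) = 1"
    using finite_field_power_card_minus_1[OF assms(2)] assms(1) by simp
  have "u ^ (3 * n) = u ^ (2 * n) * u ^ n"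
    by (simp flip: power_add)
  then have u3n: "(u ^ 3) ^ n = u ^ n"
    by (simp add: un flip: power_mult)
  have "trace_sum n (u ^ 2 * A) (u ^ 3 * B) =
      (\<Sum>x\<in>UNIV. ((u * x) ^ 3 + u ^ 2 * A * (u * x) + u ^ 3 * B) ^ n)"
    unfolding trace_sum_def
    by (rule sum.reindex_bij_witness[of _ "\<lambda>x. u * x" "\<lambda>x. x / u"]) (use assms in auto)
  also have "\<dots> = (\<Sum>x\<in>UNIV. (u ^ 3 * (x ^ 3 + A * x + B)) ^ n)"
    by (intro sum.cong refl arg_cong[where f = "\<lambda>x. x ^ n"])
      (simp add: algebra_simps power2_eq_square power3_eq_cube)
  also have "\<dots> = u ^ n * trace_sum n A B"
    by (simp add: trace_sum_def power_mult_distrib u3n sum_distrib_left)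
  finally show ?thesis .
qed

text \<open>Of the binomial expansion only the exponent \<open>s + t i = 2n\<close> survives the summation over \<open>x\<close>.\<close>

lemma sum_binomial_power:
  fixes C :: "'a::finite_field"
  assumes card: "CARD('a) = 2 * n + 1" and "n > 0" and "t > 0" and bound: "s + t * n < 4 * n"
  shows "(\<Sum>x\<in>UNIV. x ^ s * (x ^ t + C) ^ n) =
    (\<Sum>i | i \<le> n \<and> s + t * i = 2 * n.
      of_nat (n choose i) * C ^ (n - i) * (\<Sum>x\<in>UNIV. x ^ (2 * n)))"
proof -
  have vanish: "(\<Sum>x::'a\<in>UNIV. x ^ m) = 0" if "m < 4 * n" "m \<noteq> 2 * n" for m
  proof (cases "m = 0")
    \<comment> \<open>For \<open>m = 0\<close> every summand is 1, also at \<open>x = 0\<close>, so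
      the sum is q = 0.\<close>
    case True
    then show ?thesis
      using CHAR_dvd_CARD[where ?'a = 'a] by (simp add: of_nat_eq_0_iff_char_dvd)
  next
    case False
    then show ?thesis
      using that card by (intro sum_power_eq_0) auto
  qed
  have expand: "x ^ s * (x ^ t + C) ^ n =
      (\<Sum>i\<le>n. of_nat (n choose i) * C ^ (n - i) * x ^ (s + t * i))" for x
    unfolding binomial_ring sum_distrib_left power_add power_mult by (simp add: mult_ac)
  have "(\<Sum>x\<in>UNIV. x ^ s * (x ^ t + C) ^ n) =
      (\<Sum>i\<le>n. of_nat (n choose i) * C ^ (n - i) * (\<Sum>x\<in>UNIV. x ^ (s + t * i)))"
    unfolding expand by (subst sum.swap) (simp add: sum_distrib_left)
  also have "\<dots> = (\<Sum>i | i \<le> n \<and> s + t * i = 2 * n.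
      of_nat (n choose i) * C ^ (n - i) * (\<Sum>x\<in>UNIV. x ^ (s + t * i)))"
  proof (rule sum.mono_neutral_right)
    show "\<forall>i\<in>{..n} - {i. i \<le> n \<and> s + t * i = 2 * n}.
        of_nat (n choose i) * C ^ (n - i) * (\<Sum>x\<in>UNIV. x ^ (s + t * i)) = 0"
    proof
      fix i assume i: "i \<in> {..n} - {i. i \<le> n \<and> s + t * i = 2 * n}"
      then have "t * i \<le> t * n"
        by simp
      then have "s + t * i < 4 * n"
        using bound by linarith
      then show "of_nat (n choose i) * C ^ (n - i) * (\<Sum>x\<in>UNIV. x ^ (s + t * i)) = 0"
        using vanish[of "s + t * i"] i by simp
    qed
  qed auto
  also have "\<dots> = (\<Sum>i | i \<le> n \<and> s + t * i = 2 * n.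
      of_nat (n choose i) * C ^ (n - i) * (\<Sum>x\<in>UNIV. x ^ (2 * n)))"
    by (rule sum.cong) auto
  finally show ?thesis .
qed

text \<open>Since \<open>x ^ 3 + A * x = x * (x ^ 2 + A)\<close>, the surviving exponent is
  \<open>n + 2 * i = 2 * n\<close>, which forces \<open>i = n div 2\<close> and \<open>n\<close>
  even. What matters is that \<open>c\<close> does not depend on \<open>A\<close>, so that two
  curves can be compared.\<close>

lemma trace_sum_B_eq_0:
  assumes "CARD('a::finite_field) = 2 * n + 1" and "n > 0"
  shows "\<exists>c::'a. \<forall>A. trace_sum n A 0 = (if even n then c * A ^ (n div 2) else 0)"
proof -
  have "trace_sum n A 0 = (\<Sum>x\<in>UNIV. x ^ n * (x ^ 2 + A) ^ n)" for A :: 'a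
    unfolding trace_sum_def
    by (simp add: power2_eq_square power3_eq_cube algebra_simps flip: power_mult_distrib)
  also have "\<dots> A = (\<Sum>i | i \<le> n \<and> n + 2 * i = 2 * n.
      of_nat (n choose i) * A ^ (n - i) * (\<Sum>x\<in>UNIV. x ^ (2 * n)))" for A
    by (rule sum_binomial_power) (use assms in auto)
  finally have eq: "trace_sum n A 0 = (\<Sum>i | i \<le> n \<and> n + 2 * i = 2 * n.
      of_nat (n choose i) * A ^ (n - i) * (\<Sum>x\<in>UNIV. x ^ (2 * n)))" for A :: 'a .
  show ?thesis
  proof (cases "even n")
    case True
    then have "{i. i \<le> n \<and> n + 2 * i = 2 * n} = {n div 2}" and "n - n div 2 = n div 2"
      by auto
    with True show ?thesis
      by (intro exI[of _ "of_nat (n choose (n div 2)) * (\<Sum>x\<in>UNIV. x ^ (2 * n))"])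
        (simp add: eq mult_ac)
  next
    case False
    then have "n + 2 * i \<noteq> 2 * n" for i
      by presburger
    with False show ?thesis
      by (simp add: eq)
  qed
qed

text \<open>Here the surviving exponent is \<open>3 * i = 2 * n\<close>, which forces 3 to divide
  \<open>n\<close> and leaves \<open>B\<close> with exponent \<open>n - i = n div 3\<close>.\<close>

lemma trace_sum_A_eq_0:
  assumes "CARD('a::finite_field) = 2 * n + 1" and "n > 0"
  shows "\<exists>c::'a. \<forall>B. trace_sum n 0 B = (if 3 dvd n then c * B ^ (n div 3) else 0)"
proof -
  have eq: "trace_sum n 0 B = (\<Sum>i | i \<le> n \<and> 3 * i = 2 * n.
      of_nat (n choose i) * B ^ (n - i) * (\<Sum>x\<in>UNIV. x ^ (2 * n)))" for B :: 'a
    using sum_binomial_power[OF assms, of 3 0 B] assms(2) by (simp add: trace_sum_def)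
  show ?thesis
  proof (cases "3 dvd n")
    case True
    then have "{i. i \<le> n \<and> 3 * i = 2 * n} = {2 * (n div 3)}" and "n - 2 * (n div 3) = n div 3"
      by auto
    with True show ?thesis
      by (intro exI[of _ "of_nat (n choose (2 * (n div 3))) * (\<Sum>x\<in>UNIV. x ^ (2 * n))"])
        (simp add: eq mult_ac)
  next
    case False
    then have "3 * i \<noteq> 2 * n" for i
      by presburger
    with False show ?thesis
      by (simp add: eq)
  qed
qed

section \<open>Isomorphisms and twists between curves\<close>

lemma ec_group_iso:
  fixes A B w :: "'a::field"
  assumes w: "w \<noteq> 0"
  shows "ec_group A B \<cong> ec_group (w ^ 4 * A) (w ^ 6 * B)"
proof -
  \<comment> \<open>The scaling factor is a parameter, so that \<open>f (inverse k)\<close> serves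
    as the inverse map.\<close>
  define f where "f k P = (case P of Infinity \<Rightarrow> Infinity | Affine x y \<Rightarrow> Affine (k ^ 2 * x) (k ^ 3 * y))"
    for k :: 'a and P
  have f_simps [simp]: "f k Infinity = Infinity" "f k (Affine x y) = Affine (k ^ 2 * x) (k ^ 3 * y)"
    for k x y
    by (simp_all add: f_def)
  have maps: "f k P \<in> ec_points (k ^ 4 * a) (k ^ 6 * b)" if "P \<in> ec_points a b" for k P a b
  proof (cases P)
    case (Affine x y)
    then have "y ^ 2 = x ^ 3 + a * x + b"
      using that by (simp add: ec_points_def)
    then have "(k ^ 3 * y) ^ 2 = k ^ 6 * (x ^ 3 + a * x + b)"
      by (simp add: power_mult_distrib flip: power_mult)
    also have "\<dots> = (k ^ 2 * x) ^ 3 + k ^ 4 * a * (k ^ 2 * x) + k ^ 6 * b"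
      by (simp add: power_mult_distrib algebra_simps flip: power_mult power_add)
    finally show ?thesis
      using Affine by (simp add: ec_points_def)
  qed (simp add: ec_points_def)
  have inverse: "f k (f (inverse k) P) = P" if "k \<noteq> 0" for k P
    using that by (cases P) (simp_all add: power_inverse)
  have inverse': "f (inverse k) (f k P) = P" if "k \<noteq> 0" for k P
    using inverse[of "inverse k" P] that by simp
  \<comment> \<open>Slopes scale by \<open>w\<close>. This holds for all pairs, even off the curve:
    where a denominator vanishes, both slopes are 0 by the convention for division.\<close>
  have add: "f w (ec_add A P Q) = ec_add (w ^ 4 * A) (f w P) (f w Q)" for P Q
  proof (cases P; cases Q)
    fix x1 y1 x2 y2
    assume [simp]: "P = Affine x1 y1" "Q = Affine x2 y2"
    have eqs: "w ^ 2 * x1 = w ^ 2 * x2 \<longleftrightarrow> x1 = x2" "w ^ 3 * y1 = - (w ^ 3 * y2) \<longleftrightarrow> y1 = - y2"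
      using w by (simp_all flip: mult_minus_right)
    define s where
      "s = (if x1 = x2 then (3 * x1 ^ 2 + A) / (2 * y1) else (y2 - y1) / (x2 - x1))"
    have tangent: "(3 * (w ^ 2 * x1) ^ 2 + w ^ 4 * A) / (2 * (w ^ 3 * y1)) =
        w * ((3 * x1 ^ 2 + A) / (2 * y1))"
    proof -
      have "(3 * (w ^ 2 * x1) ^ 2 + w ^ 4 * A) / (2 * (w ^ 3 * y1)) =
          (w ^ 3 * (w * (3 * x1 ^ 2 + A))) / (w ^ 3 * (2 * y1))"
        by (simp add: algebra_simps eval_nat_numeral)
      also have "\<dots> = w * ((3 * x1 ^ 2 + A) / (2 * y1))"
        using w by (subst mult_divide_mult_cancel_left) auto
      finally show ?thesis .
    qed
    have chord: "(w ^ 3 * y2 - w ^ 3 * y1) / (w ^ 2 * x2 - w ^ 2 * x1) =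
        w * ((y2 - y1) / (x2 - x1))"
    proof -
      have "(w ^ 3 * y2 - w ^ 3 * y1) / (w ^ 2 * x2 - w ^ 2 * x1) =
          (w ^ 2 * (w * (y2 - y1))) / (w ^ 2 * (x2 - x1))"
        by (simp add: algebra_simps eval_nat_numeral)
      also have "\<dots> = w * ((y2 - y1) / (x2 - x1))"
        using w by (subst mult_divide_mult_cancel_left) auto
      finally show ?thesis .
    qed
    have slope: "(if x1 = x2 then (3 * (w ^ 2 * x1) ^ 2 + w ^ 4 * A) / (2 * (w ^ 3 * y1))
        else (w ^ 3 * y2 - w ^ 3 * y1) / (w ^ 2 * x2 - w ^ 2 * x1)) = w * s"
      unfolding s_def tangent chord by simp
    show ?thesis
      by (simp only: \<open>P = _\<close> \<open>Q = _\<close> f_simps ec_add.simps eqs slope Let_def flip: s_def)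
        (simp add: algebra_simps eval_nat_numeral)
  qed simp_all
  have "f w \<in> iso (ec_group A B) (ec_group (w ^ 4 * A) (w ^ 6 * B))"
  proof (rule isoI)
    show "f w \<in> hom (ec_group A B) (ec_group (w ^ 4 * A) (w ^ 6 * B))"
      by (rule homI) (auto simp: ec_group_def add maps)
    have "f (inverse w) P \<in> ec_points A B" if "P \<in> ec_points (w ^ 4 * A) (w ^ 6 * B)" for P
      using maps[OF that, of "inverse w"] w by (simp add: power_inverse flip: mult.assoc)
    then show "bij_betw (f w) (carrier (ec_group A B)) (carrier (ec_group (w ^ 4 * A) (w ^ 6 * B)))"
      by (intro bij_betw_byWitness[where f' = "f (inverse w)"])
        (use w in \<open>auto simp: ec_group_def maps inverse inverse'\<close>)
  qed
  then show ?thesis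
    by (auto simp: is_iso_def)
qed

text \<open>Clearing denominators turns equality of the invariants into
  \<open>A1 ^ 3 * B2 ^ 2 = A2 ^ 3 * B1 ^ 2\<close>. So a coefficient that vanishes on one curve
  vanishes on the other.\<close>

lemma same_j_invariant_cases:
  fixes A1 B1 A2 B2 :: "'a::field"
  assumes two: "(2::'a) \<noteq> 0" and three: "(3::'a) \<noteq> 0"
    and ell: "elliptic_curve A1 B1" "elliptic_curve A2 B2"
    and j: "j_invariant A1 B1 = j_invariant A2 B2"
  obtains (generic) u where "u \<noteq> 0" "A2 = u ^ 2 * A1" "B2 = u ^ 3 * B1"
  | (B_eq_0) "A1 \<noteq> 0" "A2 \<noteq> 0" "B1 = 0" "B2 = 0"
  | (A_eq_0) "A1 = 0" "A2 = 0" "B1 \<noteq> 0" "B2 \<noteq> 0"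
proof -
  have "(4::'a) = 2 ^ 2" "(27::'a) = 3 ^ 3" "(1728::'a) = 2 ^ 6 * 3 ^ 3"
    by simp_all
  then have nz: "(4::'a) \<noteq> 0" "(27::'a) \<noteq> 0" "(1728::'a) \<noteq> 0"
    using two three by (metis power_not_zero no_zero_divisors)+
  have D: "4 * A1 ^ 3 + 27 * B1 ^ 2 \<noteq> 0" "4 * A2 ^ 3 + 27 * B2 ^ 2 \<noteq> 0"
    using ell by (simp_all add: elliptic_curve_def)
  have "4 * A1 ^ 3 / (4 * A1 ^ 3 + 27 * B1 ^ 2) = 4 * A2 ^ 3 / (4 * A2 ^ 3 + 27 * B2 ^ 2)"
    using j nz(3) unfolding j_invariant_def by (metis mult_left_cancel)
  then have "4 * A1 ^ 3 * (4 * A2 ^ 3 + 27 * B2 ^ 2) = 4 * A2 ^ 3 * (4 * A1 ^ 3 + 27 * B1 ^ 2)"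
    by (simp only: frac_eq_eq[OF D])
  then have "(4 * 27) * (A1 ^ 3 * B2 ^ 2) = (4 * 27) * (A2 ^ 3 * B1 ^ 2)"
    by (simp add: algebra_simps)
  then have eq: "A1 ^ 3 * B2 ^ 2 = A2 ^ 3 * B1 ^ 2"
    using nz by (metis mult_left_cancel no_zero_divisors)
  consider "A1 = 0" | "B1 = 0" | "A1 \<noteq> 0" "B1 \<noteq> 0"
    by blast
  then show ?thesis
  proof cases
    case 1
    then have "B1 \<noteq> 0"
      using D by auto
    then have "A2 = 0"
      using eq 1 by auto
    then show ?thesis
      using A_eq_0 1 D by auto
  next
    case 2
    then have "A1 \<noteq> 0"
      using D by auto
    then have "B2 = 0"
      using eq 2 by auto
    then show ?thesis
      using B_eq_0 2 D by auto
  next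
    case 3
    then have 4: "A2 \<noteq> 0" "B2 \<noteq> 0"
      using eq D by auto
    \<comment> \<open>Found by dividing the desired \<open>B2 = u ^ 3 * B1\<close> by
      \<open>A2 = u ^ 2 * A1\<close>.\<close>
    define u where "u = B2 * A1 / (B1 * A2)"
    have "u ^ 2 * A1 = (A1 ^ 3 * B2 ^ 2) / (B1 ^ 2 * A2 ^ 2)"
      by (simp add: u_def power_divide power_mult_distrib eval_nat_numeral mult_ac)
    also have "\<dots> = A2"
      unfolding eq using 3 4 by (simp add: field_simps eval_nat_numeral)
    finally have a: "A2 = u ^ 2 * A1" ..
    have "u ^ 3 * B1 = (A1 ^ 3 * B2 ^ 2) * B2 / (B1 ^ 2 * A2 ^ 3)"
      using 3 by (simp add: u_def power_divide power_mult_distrib eval_nat_numeral mult_ac)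
    also have "\<dots> = B2"
      unfolding eq using 3 4 by (simp add: field_simps)
    finally have b: "B2 = u ^ 3 * B1" ..
    show ?thesis
      by (rule generic[OF _ a b]) (use 3 4 in \<open>simp add: u_def\<close>)
  qed
qed

section \<open>From equal point counts to isomorphism\<close>

lemma same_card_imp_iso:
  fixes A1 B1 A2 B2 :: "'a::finite_field"
  assumes card: "CARD('a) = 2 * n + 1" and n: "n > 0" and two: "(2::'a) \<noteq> 0" and three: "(3::'a) \<noteq> 0"
    and ell: "elliptic_curve A1 B1" "elliptic_curve A2 B2"
    and ord: "ordinary A1 B1"
    and j: "j_invariant A1 B1 = j_invariant A2 B2"
    and same: "card (ec_points A1 B1) = card (ec_points A2 B2)"
  shows "ec_group A1 B1 \<cong> ec_group A2 B2"
proof -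
  have S: "trace_sum n A1 B1 = trace_sum n A2 B2"
    using same of_nat_card_ec_points[OF card n two, of A1 B1]
      of_nat_card_ec_points[OF card n two, of A2 B2] by simp
  have S_nz: "trace_sum n A1 B1 \<noteq> 0"
    using ord ordinary_iff_trace_sum[OF card n two] by blast
  obtain w where w: "w \<noteq> 0" "A2 = w ^ 4 * A1" "B2 = w ^ 6 * B1"
  proof (use two three ell j in \<open>cases rule: same_j_invariant_cases\<close>)
    case (generic u)
    then have "u ^ n = 1"
      using S S_nz trace_sum_quadratic_twist[OF card, of u A1 B1] by simp
    then obtain w where "w \<noteq> 0" "w ^ 2 = u"
      using is_dth_power[of 2 n u] card n by auto
    with generic show ?thesis
      by (intro that[of w]) (auto simp flip: power_mult)
  next
    case B_eq_0
    obtain c where c: "\<And>A::'a. trace_sum n A 0 = (if even n then c * A ^ (n div 2) else 0)"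
      using trace_sum_B_eq_0[OF card n] by blast
    \<comment> \<open>A nonzero sum forces \<open>n\<close> to be even, so 4 divides q - 1 = 2n and
      fourth roots can be extracted.\<close>
    with S S_nz B_eq_0 have "even n" "c \<noteq> 0" "A1 ^ (n div 2) = A2 ^ (n div 2)"
      by (auto split: if_splits)
    then have "(A2 / A1) ^ (n div 2) = 1"
      using B_eq_0 by (simp add: power_divide)
    moreover have "CARD('a) - 1 = 4 * (n div 2)" "n div 2 > 0"
      using card n \<open>even n\<close> by (auto elim!: evenE)
    ultimately obtain w where "w \<noteq> 0" "w ^ 4 = A2 / A1"
      using is_dth_power[of 4 "n div 2" "A2 / A1"] by auto
    with B_eq_0 show ?thesis
      by (intro that[of w]) auto
  next
    case A_eq_0
    obtain c where c: "\<And>B::'a. trace_sum n 0 B = (if 3 dvd n then c * B ^ (n div 3) else 0)"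
      using trace_sum_A_eq_0[OF card n] by blast
    \<comment> \<open>Likewise 3 divides \<open>n\<close>, so 6 divides q - 1, as needed for a sixth
      root.\<close>
    with S S_nz A_eq_0 have "3 dvd n" "c \<noteq> 0" "B1 ^ (n div 3) = B2 ^ (n div 3)"
      by (auto split: if_splits)
    then have "(B2 / B1) ^ (n div 3) = 1"
      using A_eq_0 by (simp add: power_divide)
    moreover have "CARD('a) - 1 = 6 * (n div 3)" "n div 3 > 0"
      using card n \<open>3 dvd n\<close> by (auto elim!: dvdE)
    ultimately obtain w where "w \<noteq> 0" "w ^ 6 = B2 / B1"
      using is_dth_power[of 6 "n div 3" "B2 / B1"] by auto
    with A_eq_0 show ?thesis
      by (intro that[of w]) auto
  qed
  then show ?thesis
    using ec_group_iso by blast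
qed

theorem theorem3p3:
  fixes A1 B1 A2 B2 :: "'a::finite_field" and p r :: nat
  assumes "prime p" and "p \<noteq> 2" and "p \<noteq> 3" and "CARD('a) = p ^ r"
    and "elliptic_curve A1 B1" and "elliptic_curve A2 B2"
    and "ordinary A1 B1" and "ordinary A2 B2"
    and "j_invariant A1 B1 = j_invariant A2 B2"
  shows "card (ec_points A1 B1) = card (ec_points A2 B2) \<longleftrightarrow> ec_group A1 B1 \<cong> ec_group A2 B2"
proof
  assume "ec_group A1 B1 \<cong> ec_group A2 B2"
  then show "card (ec_points A1 B1) = card (ec_points A2 B2)"
    using iso_same_card by (fastforce simp: ec_group_def)
next
  assume same: "card (ec_points A1 B1) = card (ec_points A2 B2)"
  \<comment> \<open>The hypotheses on \<open>p\<close> become invertibility of 2 and 3 once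
    \<open>p\<close> is identified as the characteristic.\<close>
  have "CHAR('a) dvd p ^ r"
    using CHAR_dvd_CARD[where ?'a = 'a] assms(4) by simp
  then have char: "CHAR('a) = p"
    using assms(1) CHAR_prime[where ?'a = 'a] by (metis prime_dvd_power primes_dvd_imp_eq)
  have "prime (2::nat)" "prime (3::nat)"
    by simp_all
  then have "of_nat 2 \<noteq> (0::'a)" "of_nat 3 \<noteq> (0::'a)"
    unfolding of_nat_eq_0_iff_char_dvd char using assms(1-3) by (metis primes_dvd_imp_eq)+
  then have nz: "(2::'a) \<noteq> 0" "(3::'a) \<noteq> 0"
    by simp_all
  have "odd (p ^ r)"
    using assms(1,2) by (metis prime_dvd_power primes_dvd_imp_eq two_is_prime_nat)
  then obtain n where n: "CARD('a) = 2 * n + 1"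
    using assms(4) by (metis oddE)
  have "card {0, 1::'a} \<le> CARD('a)"
    by (rule card_mono) auto
  then have "n > 0"
    using n by auto
  show "ec_group A1 B1 \<cong> ec_group A2 B2"
    by (rule same_card_imp_iso) fact+
qed

end
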